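(* Let $k\ge 1$ and let $Q=\{\pi_1,\ldots,\pi_d\}$ be a symmetric set of $d$ permutations of $X=\{1,2,\ldots,(d+1)^k\}$. Let $S_Q=\{\pi_1,\ldots,\pi_d,s\}$ be the generating set, defined by the wreath recursion given in the context, of the self-similar group $G_{Q,k}=\langle S_Q\rangle$ acting on $X^*$, and let $\Gamma_n$ ($n\ge 1$) be the action graph of $S_Q$ on $X^n$. Let $\Gamma$ be the graph of the action of $Q$ on $X$. Then for every $n\ge 1$, $$\Gamma_{n+1}=\Gamma_n^k\,ⓡ\,\Gamma ,$$ where $\Gamma_n^k$ is the $k$-th power of $\Gamma_n$, $ⓡ$ denotes the replacement product, the vertex $(x,v)\in X\times X^n$ of the product is identified with $xv\in X^{n+1}$, and the edges of $\Gamma_n^k$ at each vertex $v\in X^n$ are labeled by the vertices of $\Gamma$ via $v[x]:=w_x(v)$, $x\in X$, with $w_x$ the words defined in the context (so the edge labeled $x$ at $v$ is labeled $\gamma(x)$ at $w_x(v)$).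
   Context: Graphs are regular, undirected, and may have loops and multiple edges. A set of permutations is symmetric if it is closed under inverses. Action graphs: if a finite family $S$ of generators, closed under inverses, acts on a set $V$, the action graph has vertex set $V$ and, for every $s\in S$ and $v\in V$, an edge between $v$ and $s(v)$; the edge given by $s$ at $v$ is the same undirected edge as the one given by $s^{-1}$ at $s(v)$, so the graph is $|S|$-regular (generators are counted as formal symbols). Equality of graphs is with multiplicities of edges. The $k$-th power $\Delta^k$ of a graph $\Delta$ is the graph on the vertices of $\Delta$ in which each edge corresponds to a path (walk) of length $k$ in $\Delta$; the edges of $\Gamma_n^k$ at $v$ thus correspond to the words of length $k$ over $S_Q$ applied to $v$. Wreath recursion: $X^*$ is the set of finite words over $X$. Each $\pi_i$ is regarded as the transformation of $X^*$ changing only the first letter: $\pi_i(xv)=\pi_i(x)v$ for $x\in X$, $v\in X^*$. Let $s$ be a formal symbol. There are $(d+1)^k$ words of length $k$ over $S_Q$ (treated as a set of $d+1$ symbols); fix an order on them: $w_1,\ldots,w_{(d+1)^k}$. Let $\gamma$ be the involution on $X$ such that if $w_x=t_1t_2\cdots t_k$ with $t_j\in S_Q$ then $w_{\gamma(x)}=t_k^{-1}\cdots t_2^{-1}t_1^{-1}$, where $\pi_i^{-1}$ is the inverse permutation (an element of $Q$) and for the symbol $s$ one puts $s^{-1}:=s$. The symbol $s$ acts on $X^*$ (left action, fixing the empty word, preserving length) by the recursive rule $$s(xv)=\gamma(x)\,w_x(v),\qquad x\in X,\ v\in X^*,$$ where words act by composition. This is an invertible transformation with $s^2=e$, and $G_{Q,k}$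 is the group generated by $\pi_1,\ldots,\pi_d,s$ under composition. Replacement product: let $\mathcal G$ be a $D$-regular graph and $\Gamma$ a $\delta$-regular graph on $D$ vertices. The edges at each vertex of $\mathcal G$ are labeled by the vertices of $\Gamma$ in one-to-one fashion; $v[x]$ denotes the neighbor of $v$ along the edge labeled $x$ at $v$. The replacement product $\mathcal G\,ⓡ\,\Gamma$ is the $(\delta+1)$-regular graph with vertex set $V(\Gamma)\times V(\mathcal G)$ and the following edges: (1) for every edge $x - y$ of $\Gamma$ and every $v\in V(\mathcal G)$ an edge $(x,v) - (y,v)$; (2) for every edge of $\mathcal G$ joining $v$ and $u$ that is labeled $x$ at $v$ and $y$ at $u$, an edge $(x,v) - (y,u)$. The product depends on the chosen labeling. *)

theory Defs
  imports "HOL-Combinatorics.Permutations"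
begin

section \<open>Undirected graphs with loops and multiple edges\<close>

text \<open>
  A graph is given by its darts (oriented edges): every dart \<open>e\<close> has an origin and an opposite
  dart \<open>opp e\<close>, and an undirected edge is a set \<open>{e, opp e}\<close>.  A dart may be its own
  opposite (it is then a loop that contributes 1 to the degree), as happens for an involutive
  generator fixing a vertex of an action graph; any other loop contributes 2.
\<close>

record ('v, 'e) mgraph =
  verts :: "'v set"
  darts :: "'e set"
  origin :: "'e \<Rightarrow> 'v"
  opp :: "'e \<Rightarrow> 'e"

definition target :: "('v, 'e) mgraph \<Rightarrow> 'e \<Rightarrow> 'v" where
  "target G e = origin G (opp G e)"

definition wf_mgraph :: "('v, 'e) mgraph \<Rightarrow> bool" where
  "wf_mgraph G \<longleftrightarrow>
     (\<forall>e\<in>darts G. origin G e \<in> verts G \<and> opp G e \<in> darts G \<and> opp G (opp G e) = e)"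

definition darts_at :: "('v, 'e) mgraph \<Rightarrow> 'v \<Rightarrow> 'e set" where
  "darts_at G v = {e \<in> darts G. origin G e = v}"

definition regular :: "nat \<Rightarrow> ('v, 'e) mgraph \<Rightarrow> bool" where
  "regular D G \<longleftrightarrow> (\<forall>v\<in>verts G. finite (darts_at G v) \<and> card (darts_at G v) = D)"

text \<open>
  Equality of graphs with multiplicities: the vertex sets are literally equal, and there is a
  bijection of the darts that preserves origins and opposites, hence the end-points and the
  multiplicity of every undirected edge.
\<close>

definition same_graph :: "('v, 'e) mgraph \<Rightarrow> ('v, 'f) mgraph \<Rightarrow> bool" where
  "same_graph G H \<longleftrightarrow> verts G = verts H \<and>
     (\<exists>\<phi>. bij_betw \<phi> (darts G) (darts H) \<and>
          (\<forall>e\<in>darts G. origin H (\<phi> e) = origin G e \<and> \<phi> (opp G e) = opp H (\<phi> e)))"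

definition rename_verts :: "('v \<Rightarrow> 'u) \<Rightarrow> ('v, 'e) mgraph \<Rightarrow> ('u, 'e) mgraph" where
  "rename_verts f G =
     \<lparr>verts = f ` verts G, darts = darts G, origin = f \<circ> origin G, opp = opp G\<rparr>"

definition action_graph ::
    "'s set \<Rightarrow> ('s \<Rightarrow> 's) \<Rightarrow> ('s \<Rightarrow> 'v \<Rightarrow> 'v) \<Rightarrow> 'v set \<Rightarrow> ('v, 's \<times> 'v) mgraph" where
  "action_graph S \<iota> act V =
     \<lparr>verts = V, darts = S \<times> V, origin = snd, opp = (\<lambda>(s, v). (\<iota> s, act s v))\<rparr>"

primrec walk :: "('v, 'e) mgraph \<Rightarrow> 'v \<Rightarrow> 'e list \<Rightarrow> bool" where
  "walk G v [] \<longleftrightarrow> v \<in> verts G"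
| "walk G v (e # p) \<longleftrightarrow> e \<in> darts G \<and> origin G e = v \<and> walk G (target G e) p"

definition walk_end :: "('v, 'e) mgraph \<Rightarrow> 'v \<Rightarrow> 'e list \<Rightarrow> 'v" where
  "walk_end G v p = (if p = [] then v else target G (last p))"

text \<open>A dart of the power is a walk together with its initial vertex; its opposite is the
  walk traversed backwards.\<close>

definition graph_power :: "('v, 'e) mgraph \<Rightarrow> nat \<Rightarrow> ('v, 'v \<times> 'e list) mgraph" where
  "graph_power G k =
     \<lparr>verts = verts G,
      darts = {(v, p). walk G v p \<and> length p = k},
      origin = fst,
      opp = (\<lambda>(v, p). (walk_end G v p, rev (map (opp G) p)))\<rparr>"

text \<open>
  The label of an edge at its end-point \<open>v\<close> is the label \<open>lab e\<close> of the dart \<open>e\<close> with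
  origin \<open>v\<close>; its label at the other end-point is \<open>lab (opp e)\<close>.
\<close>

definition edge_labeling :: "('v, 'e) mgraph \<Rightarrow> 'x set \<Rightarrow> ('e \<Rightarrow> 'x) \<Rightarrow> bool" where
  "edge_labeling G L lab \<longleftrightarrow> (\<forall>v\<in>verts G. bij_betw lab (darts_at G v) L)"

definition dart_with_label :: "('v, 'e) mgraph \<Rightarrow> ('e \<Rightarrow> 'x) \<Rightarrow> 'v \<Rightarrow> 'x \<Rightarrow> 'e" where
  "dart_with_label G lab v x = the_inv_into (darts_at G v) lab x"

definition neighbor :: "('v, 'e) mgraph \<Rightarrow> ('e \<Rightarrow> 'x) \<Rightarrow> 'v \<Rightarrow> 'x \<Rightarrow> 'v" where
  "neighbor G lab v x = target G (dart_with_label G lab v x)"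

definition replacement_data ::
    "nat \<Rightarrow> nat \<Rightarrow> ('v, 'e) mgraph \<Rightarrow> ('x, 'f) mgraph \<Rightarrow> ('e \<Rightarrow> 'x) \<Rightarrow> bool" where
  "replacement_data D \<delta> G H lab \<longleftrightarrow>
     wf_mgraph G \<and> regular D G \<and>
     wf_mgraph H \<and> regular \<delta> H \<and> finite (verts H) \<and> card (verts H) = D \<and>
     edge_labeling G (verts H) lab"

definition replacement_product ::
    "('v, 'e) mgraph \<Rightarrow> ('x, 'f) mgraph \<Rightarrow> ('e \<Rightarrow> 'x) \<Rightarrow> ('x \<times> 'v, ('f \<times> 'v) + 'e) mgraph" where
  "replacement_product G H lab =
     \<lparr>verts = verts H \<times> verts G,
      darts = (darts H \<times> verts G) <+> darts G,
      origin = case_sum (\<lambda>(f, v). (origin H f, v)) (\<lambda>e. (lab e, origin G e)),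
      opp = case_sum (\<lambda>(f, v). Inl (opp H f, v)) (\<lambda>e. Inr (opp G e))\<rparr>"


section \<open>Wreath recursion\<close>

text \<open>The symbol \<open>S\<close> stays distinct from every \<open>P \<pi>\<close>, even if the two act equally.\<close>

datatype symbol = P "nat \<Rightarrow> nat" | S

definition symbols :: "(nat \<Rightarrow> nat) set \<Rightarrow> symbol set" where
  "symbols Q = insert S (P ` Q)"

fun inv_symbol :: "symbol \<Rightarrow> symbol" where
  "inv_symbol (P \<pi>) = P (inv \<pi>)"
| "inv_symbol S = S"

definition inv_word :: "symbol list \<Rightarrow> symbol list" where
  "inv_word t = rev (map inv_symbol t)"

definition words :: "'a set \<Rightarrow> nat \<Rightarrow> 'a list set" where
  "words A n = {u. set u \<subseteq> A \<and> length u = n}"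

definition \<gamma> :: "nat set \<Rightarrow> (nat \<Rightarrow> symbol list) \<Rightarrow> nat \<Rightarrow> nat" where
  "\<gamma> X w x = the_inv_into X w (inv_word (w x))"

text \<open>\<open>X\<close> is the alphabet and \<open>w\<close> the enumeration of the words of length \<open>k\<close> by \<open>X\<close>.
  Words act by composition from the left, so their last symbol acts first.\<close>

function (domintros)
  act :: "nat set \<Rightarrow> (nat \<Rightarrow> symbol list) \<Rightarrow> symbol \<Rightarrow> nat list \<Rightarrow> nat list" and
  act_word :: "nat set \<Rightarrow> (nat \<Rightarrow> symbol list) \<Rightarrow> symbol list \<Rightarrow> nat list \<Rightarrow> nat list"
where
  "act X w t [] = []"
| "act X w (P \<pi>) (x # v) = \<pi> x # v"
| "act X w S (x # v) = \<gamma> X w x # act_word X w (w x) v"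
| "act_word X w [] v = v"
| "act_word X w (t # ts) v = act X w t (act_word X w ts v)"
  by pat_completeness auto

lemma act_length_partial:
  shows "act_act_word_dom (Inl (X, w, t, u)) \<Longrightarrow> length (act X w t u) = length u"
    and "act_act_word_dom (Inr (X, w, ts, u)) \<Longrightarrow> length (act_word X w ts u) = length u"
  by (induction X w t u and X w ts u rule: act_act_word.pinduct)
     (simp_all add: act.psimps act_word.psimps)

termination
proof (relation "measures [case_sum (\<lambda>(X, w, t, u). length u) (\<lambda>(X, w, ts, u). length u),
                           case_sum (\<lambda>_. 0) (\<lambda>(X, w, ts, u). Suc (length ts))]", goal_cases)
  case (4 X w t ts v)
  then show ?case by (simp add: act_length_partial)
qed simp_all

definition level_graph ::
    "(nat \<Rightarrow> nat) set \<Rightarrow> nat set \<Rightarrow> (nat \<Rightarrow> symbol list) \<Rightarrow> nat \<Rightarrow>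
      (nat list, symbol \<times> nat list) mgraph" where
  "level_graph Q X w n = action_graph (symbols Q) inv_symbol (act X w) (words X n)"

definition base_graph :: "(nat \<Rightarrow> nat) set \<Rightarrow> nat set \<Rightarrow> (nat, (nat \<Rightarrow> nat) \<times> nat) mgraph" where
  "base_graph Q X = action_graph Q inv (\<lambda>\<pi> x. \<pi> x) X"

text \<open>
  A walk in an action graph traverses the darts of the symbols in the order in which they are
  applied, which is the reverse of the order in which they are written in the word.
\<close>

definition word_label ::
    "nat set \<Rightarrow> (nat \<Rightarrow> symbol list) \<Rightarrow> 'v \<times> (symbol \<times> 'v) list \<Rightarrow> nat" where
  "word_label X w = (\<lambda>(v, p). the_inv_into X w (rev (map fst p)))"

end

theory Submission
  imports Defs
begin

text \<open>
  A walk in an action graph is determined by its initial vertex and the sequence of the symbols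
  it applies, so the darts of \<open>\<Gamma>\<^sub>n\<^sup>k\<close> at \<open>v\<close> correspond to the words of length \<open>k\<close>, hence to the
  letters \<open>x\<close>.  The darts of \<open>\<Gamma>\<^sub>n\<^sub>+\<^sub>1\<close> given by \<open>\<pi>\<^sub>i\<close> are those of the copies of \<open>\<Gamma>\<close>, and the
  dart given by \<open>s\<close> at \<open>xv\<close> is the walk of \<open>w\<^sub>x\<close> starting at \<open>v\<close>.  Reversing this walk is the same as
  inverting the word, i.e. passing from \<open>x\<close> to \<open>\<gamma>(x)\<close>, which is what \<open>s\<close> does to the first letter.
\<close>

section \<open>Walks in action graphs, their reversal, and powers of action graphs\<close>

primrec trace :: "('s \<Rightarrow> 'v \<Rightarrow> 'v) \<Rightarrow> 'v \<Rightarrow> 's list \<Rightarrow> ('s \<times> 'v) list" where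
  "trace a v [] = []"
| "trace a v (t # ts) = (t, v) # trace a (a t v) ts"

lemma map_fst_trace [simp]: "map fst (trace a v ts) = ts"
  by (induction ts arbitrary: v) auto

lemma length_trace [simp]: "length (trace a v ts) = length ts"
  by (induction ts arbitrary: v) auto

lemma trace_append: "trace a v (ts @ us) = trace a v ts @ trace a (fold a ts v) us"
  by (induction ts arbitrary: v) auto

text \<open>Instantiated twice: by the symbols acting on the words of a level and by
  \<open>Q\<close> acting on \<open>X\<close>. The inverse \<open>\<iota>\<close> is formal, so
  symbols with equal action stay distinct. The laws are required only on \<open>S\<close> and
  \<open>V\<close>, since both functions are arbitrary elsewhere.\<close>

locale symmetric_action =
  fixes S :: "'s set" and \<iota> :: "'s \<Rightarrow> 's" and a :: "'s \<Rightarrow> 'v \<Rightarrow> 'v" and V :: "'v set"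
  assumes inv_closed: "s \<in> S \<Longrightarrow> \<iota> s \<in> S"
    and inv_inv: "s \<in> S \<Longrightarrow> \<iota> (\<iota> s) = s"
    and closed: "s \<in> S \<Longrightarrow> v \<in> V \<Longrightarrow> a s v \<in> V"
    and inv_act: "s \<in> S \<Longrightarrow> v \<in> V \<Longrightarrow> a (\<iota> s) (a s v) = v"
begin

abbreviation graph :: "('v, 's \<times> 'v) mgraph" where
  "graph \<equiv> action_graph S \<iota> a V"

lemma wf_action_graph: "wf_mgraph graph"
  by (auto simp: wf_mgraph_def action_graph_def inv_closed inv_inv closed inv_act)

lemma regular_action_graph:
  assumes "finite S"
  shows "regular (card S) graph"
proof -
  have "darts_at graph v = S \<times> {v}" if "v \<in> V" for v
    using that by (auto simp: darts_at_def action_graph_def)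
  then show ?thesis
    using assms by (simp add: regular_def card_cartesian_product action_graph_def)
qed

lemma target_action_graph [simp]: "target graph (s, v) = a s v"
  by (simp add: target_def action_graph_def)

text \<open>The vertex of each dart is forced to be the target of the preceding dart, so only the
  symbols are free; closure of \<open>V\<close> keeps all later vertices in
  \<open>V\<close>.\<close>

lemma walk_action_graph_iff:
  "walk graph v p \<longleftrightarrow> v \<in> V \<and> set (map fst p) \<subseteq> S \<and> trace a v (map fst p) = p"
proof (induction p arbitrary: v)
  case Nil
  then show ?case by (simp add: action_graph_def)
next
  case (Cons e p)
  obtain s u where e: "e = (s, u)" by fastforce
  have "walk graph v (e # p) \<longleftrightarrow> s \<in> S \<and> u \<in> V \<and> u = v \<and> walk graph (a s u) p"
    unfolding e by (auto simp: target_def action_graph_def)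
  then show ?case using Cons.IH[of "a s u"] closed[of s u] by (auto simp: e)
qed

lemma walk_end_trace: "walk_end graph v (trace a v ts) = fold a ts v"
proof (cases ts rule: rev_cases)
  case (snoc us t)
  then show ?thesis by (simp add: walk_end_def trace_append)
qed (simp add: walk_end_def)

lemma fold_closed: "set ts \<subseteq> S \<Longrightarrow> v \<in> V \<Longrightarrow> fold a ts v \<in> V"
  by (induction ts arbitrary: v) (auto simp: closed)

lemma fold_inverse:
  "set ts \<subseteq> S \<Longrightarrow> v \<in> V \<Longrightarrow> fold a (rev (map \<iota> ts)) (fold a ts v) = v"
  by (induction ts arbitrary: v) (auto simp: closed inv_act)

text \<open>By \<open>fold_inverse\<close> the reversed tail of the walk leads back to
  \<open>a t v\<close>, which is where the opposite \<open>(\<iota> t, a t v)\<close> of the first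
  dart begins.\<close>

lemma reverse_trace:
  assumes "set ts \<subseteq> S" "v \<in> V"
  shows "rev (map (opp graph) (trace a v ts)) = trace a (fold a ts v) (rev (map \<iota> ts))"
  using assms
proof (induction ts arbitrary: v)
  case (Cons t ts)
  then show ?case
    by (simp add: trace_append fold_inverse closed) (simp add: action_graph_def)
qed simp

lemma darts_power:
  "darts (graph_power graph k) = {(v, trace a v ts) |v ts. v \<in> V \<and> ts \<in> words S k}"
    (is "_ = ?D")
proof -
  have "walk graph v p \<and> length p = k \<longleftrightarrow> (v, p) \<in> ?D" for v p
  proof
    assume "walk graph v p \<and> length p = k"
    then have "v \<in> V \<and> map fst p \<in> words S k" "trace a v (map fst p) = p"
      by (simp_all add: walk_action_graph_iff words_def)
    then show "(v, p) \<in> ?D"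
      by (metis (mono_tags, lifting) mem_Collect_eq)
  next
    assume "(v, p) \<in> ?D"
    then obtain ts where "p = trace a v ts" "v \<in> V" "ts \<in> words S k"
      by blast
    then show "walk graph v p \<and> length p = k"
      by (simp add: walk_action_graph_iff words_def)
  qed
  then show ?thesis
    by (simp add: graph_power_def set_eq_iff split: prod.splits)
qed

lemma opp_power_trace:
  assumes "ts \<in> words S k" "v \<in> V"
  shows "opp (graph_power graph k) (v, trace a v ts) =
    (fold a ts v, trace a (fold a ts v) (rev (map \<iota> ts)))"
  using assms by (simp add: graph_power_def walk_end_trace reverse_trace words_def)

lemma rev_inv_words: "ts \<in> words S k \<Longrightarrow> rev (map \<iota> ts) \<in> words S k"
  by (auto simp: words_def inv_closed)

lemma wf_power: "wf_mgraph (graph_power graph k)"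
proof -
  let ?G = "graph_power graph k"
  have "origin ?G e \<in> verts ?G \<and> opp ?G e \<in> darts ?G \<and> opp ?G (opp ?G e) = e"
    if dart: "e \<in> darts ?G" for e
  proof -
    obtain v ts where e: "e = (v, trace a v ts)" and v: "v \<in> V" and ts: "ts \<in> words S k"
      using dart by (auto simp: darts_power)
    have fV: "fold a ts v \<in> V"
      using ts v by (simp add: fold_closed words_def)
    \<comment> \<open>Reversing twice applies \<open>\<iota>\<close> twice to each symbol, while
      \<open>fold_inverse\<close> restores the initial vertex.\<close>
    have "map (\<iota> \<circ> \<iota>) ts = ts"
      using ts by (intro map_idI) (auto simp: words_def inv_inv)
    then have "opp ?G (opp ?G e) = e"
      using ts v opp_power_trace[OF rev_inv_words[OF ts] fV] fold_inverse[of ts v]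
      by (simp add: e opp_power_trace words_def rev_map)
    moreover have "opp ?G e \<in> darts ?G"
      using rev_inv_words[OF ts] fV by (auto simp: e opp_power_trace[OF ts v] darts_power)
    ultimately show ?thesis
      using v by (simp add: e graph_power_def action_graph_def)
  qed
  then show ?thesis by (simp add: wf_mgraph_def)
qed

lemma darts_at_power:
  assumes "v \<in> V"
  shows "darts_at (graph_power graph k) v = (\<lambda>ts. (v, trace a v ts)) ` words S k"
proof -
  have "origin (graph_power graph k) = fst"
    by (simp add: graph_power_def)
  with assms show ?thesis
    by (auto simp: darts_at_def darts_power)
qed

end

section \<open>The wreath recursion and its invertibility on every level\<close>

lemma act_word_eq_fold: "act_word X w ts v = fold (act X w) (rev ts) v"
  by (induction ts) simp_all

lemma bij_betw_rev_words: "bij_betw rev (words A k) (words A k)"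
  by (rule bij_betw_byWitness[where f' = rev]) (auto simp: words_def)

lemma words_Suc_iff: "u \<in> words A (Suc n) \<longleftrightarrow> (\<exists>x v. u = x # v \<and> x \<in> A \<and> v \<in> words A n)"
  by (cases u) (auto simp: words_def)

locale wreath =
  fixes Q :: "(nat \<Rightarrow> nat) set" and X :: "nat set" and w :: "nat \<Rightarrow> symbol list" and k :: nat
  assumes permutes: "\<pi> \<in> Q \<Longrightarrow> \<pi> permutes X"
    and inv_mem: "\<pi> \<in> Q \<Longrightarrow> inv \<pi> \<in> Q"
    and enum: "bij_betw w X (words (symbols Q) k)"
begin

lemma inv_symbol_mem: "t \<in> symbols Q \<Longrightarrow> inv_symbol t \<in> symbols Q"
  by (auto simp: symbols_def inv_mem)

lemma inv_symbol_inv_symbol: "t \<in> symbols Q \<Longrightarrow> inv_symbol (inv_symbol t) = t"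
  by (auto simp: symbols_def inv_inv_eq permutes_bij[OF permutes])

lemma w_mem: "x \<in> X \<Longrightarrow> w x \<in> words (symbols Q) k"
  using enum by (rule bij_betwE[THEN bspec])

lemma the_inv_w [simp]: "x \<in> X \<Longrightarrow> the_inv_into X w (w x) = x"
  using enum by (simp add: bij_betw_def the_inv_into_f_f)

lemma inv_word_mem: "ts \<in> words (symbols Q) m \<Longrightarrow> inv_word ts \<in> words (symbols Q) m"
  by (auto simp: words_def inv_word_def inv_symbol_mem)

lemma inv_word_inv_word: "ts \<in> words (symbols Q) m \<Longrightarrow> inv_word (inv_word ts) = ts"
  by (auto simp: words_def inv_word_def rev_map inv_symbol_inv_symbol intro!: map_idI)

text \<open>Inverting a word keeps its length and its alphabet, so the result occurs in the
  enumeration and the partial inverse in \<open>\<gamma>\<close> is applied inside its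
  domain.\<close>

lemma w_\<gamma>: "x \<in> X \<Longrightarrow> w (\<gamma> X w x) = inv_word (w x)"
  unfolding \<gamma>_def using f_the_inv_into_f_bij_betw[OF enum] inv_word_mem[OF w_mem] by blast

lemma \<gamma>_mem: "x \<in> X \<Longrightarrow> \<gamma> X w x \<in> X"
  unfolding \<gamma>_def
  using bij_betwE[OF bij_betw_the_inv_into[OF enum]] inv_word_mem[OF w_mem] by blast

lemma \<gamma>_\<gamma>: "x \<in> X \<Longrightarrow> \<gamma> X w (\<gamma> X w x) = x"
  \<comment> \<open>Only the outer \<open>\<gamma>\<close> is unfolded; \<open>w_\<gamma>\<close>
    handles the inner one, leaving a word inverted twice.\<close>
  by (simp add: \<gamma>_def[of X w "\<gamma> X w x"] w_\<gamma> inv_word_inv_word[OF w_mem])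

text \<open>Induction on the level: \<open>S\<close> moves the tail by \<open>w x\<close>, which is
  invertible one level below. A second \<open>S\<close> sees the letter
  \<open>\<gamma> X w x\<close>, hence moves the tail by the inverse word and returns the first
  letter to \<open>x\<close>.\<close>

lemma symmetric_action_words:
  "symmetric_action (symbols Q) inv_symbol (act X w) (words X n)"
proof (induction n)
  case 0
  show ?case
    by unfold_locales
      (auto simp: inv_symbol_mem inv_symbol_inv_symbol words_def)
next
  case (Suc n)
  interpret IH: symmetric_action "symbols Q" inv_symbol "act X w" "words X n"
    by (fact Suc)
  have w: "set (w x) \<subseteq> symbols Q" if "x \<in> X" for x
    using w_mem[OF that] by (simp add: words_def)
  have closed: "act_word X w (w x) v \<in> words X n" if "x \<in> X" "v \<in> words X n" for x v
    using that w by (simp add: act_word_eq_fold IH.fold_closed)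
  have inverse: "act_word X w (inv_word (w x)) (act_word X w (w x) v) = v"
    if "x \<in> X" "v \<in> words X n" for x v
    \<comment> \<open>\<open>rev (w x)\<close> lists the symbols in their order of action; reversing
      it and inverting its symbols gives the inverse word in its own order of action.\<close>
    using IH.fold_inverse[of "rev (w x)" v] that w
    by (simp add: act_word_eq_fold inv_word_def rev_map)
  show ?case
  proof
    fix t u
    assume "t \<in> symbols Q" "u \<in> words X (Suc n)"
    then show "act X w t u \<in> words X (Suc n)"
        and "act X w (inv_symbol t) (act X w t u) = u"
      using permutes
      by (auto simp: symbols_def words_Suc_iff closed inverse \<gamma>_mem \<gamma>_\<gamma> w_\<gamma> permutes_in_image
          permutes_inverses(2)[OF permutes])
  qed (auto simp: inv_symbol_mem inv_symbol_inv_symbol)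
qed

lemma symmetric_action_letters: "symmetric_action Q inv (\<lambda>\<pi> x. \<pi> x) X"
  by unfold_locales
    (auto simp: inv_mem inv_inv_eq permutes_bij[OF permutes] permutes_in_image[OF permutes]
      permutes_inverses(2)[OF permutes])

section \<open>The labeled power of a level graph and the next level\<close>

context
  fixes n :: nat
begin

interpretation act: symmetric_action "symbols Q" inv_symbol "act X w" "words X n"
  by (rule symmetric_action_words)

interpretation letters: symmetric_action Q inv "\<lambda>\<pi> x. \<pi> x" X
  by (rule symmetric_action_letters)

abbreviation level_power where "level_power \<equiv> graph_power (level_graph Q X w n) k"

abbreviation lab :: "nat list \<times> (symbol \<times> nat list) list \<Rightarrow> nat"
  where "lab \<equiv> word_label X w"

text \<open>This walk is the edge of the power that carries the label \<open>x\<close> at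
  \<open>v\<close>.\<close>

definition dart where "dart v x = (v, trace (act X w) v (rev (w x)))"

lemma rev_w_mem: "x \<in> X \<Longrightarrow> rev (w x) \<in> words (symbols Q) k"
  using w_mem by (simp add: words_def)

text \<open>Reversal permutes the words of length \<open>k\<close>, so the symbol sequences of walks
  are enumerated by \<open>X\<close> as well.\<close>

lemma rev_w_image: "(\<lambda>x. rev (w x)) ` X = words (symbols Q) k"
  using bij_betw_trans[OF enum bij_betw_rev_words] by (simp add: bij_betw_def comp_def)

lemma lab_dart [simp]: "x \<in> X \<Longrightarrow> lab (dart v x) = x"
  by (simp add: word_label_def dart_def)

lemma origin_dart [simp]: "origin level_power (dart v x) = v"
  by (simp add: graph_power_def dart_def)

lemma darts_at_power_dart: "v \<in> words X n \<Longrightarrow> darts_at level_power v = dart v ` X"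
  by (simp add: level_graph_def act.darts_at_power dart_def flip: rev_w_image)
    (simp add: image_image)

lemma bij_lab: "v \<in> words X n \<Longrightarrow> bij_betw lab (darts_at level_power v) X"
  by (rule bij_betw_byWitness[where f' = "dart v"]) (auto simp: darts_at_power_dart)

lemma darts_power_dart: "darts level_power = {dart v x |v x. v \<in> words X n \<and> x \<in> X}"
  unfolding level_graph_def act.darts_power rev_w_image[symmetric] dart_def by blast

lemma verts_power [simp]: "verts level_power = words X n"
  by (simp add: graph_power_def level_graph_def action_graph_def)

text \<open>The walk of \<open>w x\<close> traversed backwards applies the inverse word, which is
  the word with index \<open>\<gamma> X w x\<close>. This is the recursive rule for \<open>S\<close>
  read in the power graph.\<close>

lemma opp_dart:
  assumes "v \<in> words X n" "x \<in> X"
  shows "opp level_power (dart v x) = dart (act_word X w (w x) v) (\<gamma> X w x)"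
  using act.opp_power_trace[OF rev_w_mem] assms
  by (simp add: dart_def level_graph_def w_\<gamma> inv_word_def act_word_eq_fold rev_map)

lemma dart_with_label_eq:
  assumes "v \<in> words X n" "x \<in> X"
  shows "dart_with_label level_power lab v x = dart v x"
  unfolding dart_with_label_def
  using assms bij_lab[of v]
  by (intro the_inv_into_f_eq) (auto simp: bij_betw_def darts_at_power_dart)

lemma replacement_data_power:
  assumes "finite Q" "finite X"
  shows "replacement_data (card X) (card Q) level_power (base_graph Q X) lab"
proof -
  \<comment> \<open>The degree is read off the labeling, which is a bijection from the darts at each
    vertex onto \<open>X\<close>.\<close>
  have "regular (card X) level_power"
    using bij_lab bij_betw_finite[OF bij_lab] bij_betw_same_card[OF bij_lab] assms
    by (simp add: regular_def)
  then show ?thesis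
    using assms letters.wf_action_graph letters.regular_action_graph act.wf_power[of k] bij_lab
    by (simp add: replacement_data_def base_graph_def edge_labeling_def level_graph_def[symmetric])
      (simp add: action_graph_def)
qed

lemma neighbor_power:
  assumes "v \<in> words X n" "x \<in> X"
  shows "neighbor level_power lab v x = act_word X w (w x) v"
  using assms by (simp add: neighbor_def dart_with_label_eq target_def opp_dart)

lemma lab_opp_power:
  assumes "v \<in> words X n" "x \<in> X"
  shows "lab (opp level_power (dart_with_label level_power lab v x)) = \<gamma> X w x"
  using assms by (simp add: dart_with_label_eq opp_dart \<gamma>_mem)

text \<open>The witness for \<open>same_graph\<close>. The value at the empty word is arbitrary,
  because no vertex of level \<open>Suc n\<close> is empty.\<close>

fun dart_map where
  "dart_map (P \<pi>, x # v) = Inl ((\<pi>, x), v)"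
| "dart_map (S, x # v) = Inr (dart v x)"
| "dart_map (t, []) = undefined"

lemma level_graph_Suc:
  "same_graph (level_graph Q X w (Suc n))
     (rename_verts (\<lambda>(x, v). x # v) (replacement_product level_power (base_graph Q X) lab))"
    (is "same_graph ?L ?R")
proof -
  have darts_L: "darts ?L = symbols Q \<times> words X (Suc n)"
    by (simp add: level_graph_def action_graph_def)
  have origin_L: "origin ?L = snd"
    and opp_L: "opp ?L = (\<lambda>(t, v). (inv_symbol t, act X w t v))"
    by (simp_all add: level_graph_def action_graph_def)
  have darts_R: "darts ?R = ((Q \<times> X) \<times> words X n) <+> darts level_power"
    by (simp add: rename_verts_def replacement_product_def base_graph_def action_graph_def)
  have verts: "verts ?L = verts ?R"
    by (auto simp: rename_verts_def replacement_product_def base_graph_def level_graph_def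
        action_graph_def graph_power_def words_Suc_iff)
  have inj: "inj_on dart_map (darts ?L)"
  proof (rule inj_onI)
    fix e f
    assume "e \<in> darts ?L" "f \<in> darts ?L" "dart_map e = dart_map f"
    \<comment> \<open>A dart of the power determines \<open>v\<close> as its origin and
      \<open>x\<close> as its label; darts of permutations and of \<open>S\<close> are separated by
      the two injections of the sum.\<close>
    moreover have "v = u \<and> x = y" if "dart v x = dart u y" "x \<in> X" "y \<in> X" for v u x y
      using that by (metis lab_dart origin_dart)
    ultimately show "e = f"
      by (auto simp: darts_L symbols_def words_Suc_iff)
  qed
  have "dart_map ` darts ?L = darts ?R"
  proof
    show "dart_map ` darts ?L \<subseteq> darts ?R"
      by (auto simp: darts_L darts_R symbols_def words_Suc_iff darts_power_dart) blast
    have "Inl ((\<pi>, x), v) \<in> dart_map ` darts ?L" if "\<pi> \<in> Q" "x \<in> X" "v \<in> words X n" for \<pi> x v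
      using that by (intro image_eqI[of _ _ "(P \<pi>, x # v)"])
        (auto simp: darts_L symbols_def words_Suc_iff)
    moreover have "Inr (dart v x) \<in> dart_map ` darts ?L" if "x \<in> X" "v \<in> words X n" for x v
      using that by (intro image_eqI[of _ _ "(S, x # v)"])
        (auto simp: darts_L symbols_def words_Suc_iff)
    ultimately show "darts ?R \<subseteq> dart_map ` darts ?L"
      by (auto simp: darts_R darts_power_dart)
  qed
  with inj have "bij_betw dart_map (darts ?L) (darts ?R)"
    by (simp add: bij_betw_def)
  \<comment> \<open>For \<open>P \<pi>\<close> the tail is unchanged and the opposite is taken in a
    copy of the base graph; for \<open>S\<close> the compatibility with opposites is
    \<open>opp_dart\<close>.\<close>
  moreover have "origin ?R (dart_map e) = origin ?L e \<and> dart_map (opp ?L e) = opp ?R (dart_map e)"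
    if "e \<in> darts ?L" for e
    using that unfolding darts_L origin_L opp_L
    by (auto simp: symbols_def words_Suc_iff rename_verts_def replacement_product_def
        base_graph_def action_graph_def[of Q] opp_dart)
  ultimately show ?thesis
    using verts unfolding same_graph_def by blast
qed

end

end

theorem theorem4:
  fixes Q :: "(nat \<Rightarrow> nat) set" and X :: "nat set" and w :: "nat \<Rightarrow> symbol list"
    and d k n :: nat
  assumes "k \<ge> 1"
    and "finite Q" and "card Q = d"
    and "X = {1..(d + 1) ^ k}"
    and "\<And>\<pi>. \<pi> \<in> Q \<Longrightarrow> \<pi> permutes X"
    and "\<And>\<pi>. \<pi> \<in> Q \<Longrightarrow> inv \<pi> \<in> Q"
    and "bij_betw w X (words (symbols Q) k)"
    and "n \<ge> 1"
  shows
    "let G = graph_power (level_graph Q X w n) k;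
         H = base_graph Q X;
         lab = word_label X w
     in replacement_data ((d + 1) ^ k) d G H lab \<and>
        (\<forall>v\<in>words X n. \<forall>x\<in>X. neighbor G lab v x = act_word X w (w x) v) \<and>
        (\<forall>v\<in>words X n. \<forall>x\<in>X. lab (opp G (dart_with_label G lab v x)) = \<gamma> X w x) \<and>
        same_graph (level_graph Q X w (n + 1))
          (rename_verts (\<lambda>(x, v). x # v) (replacement_product G H lab))"
proof -
  interpret wreath Q X w k
    using assms by unfold_locales
  \<comment> \<open>The interval \<open>X\<close> is finite with \<open>(d + 1) ^ k\<close>
    elements, which turns \<open>card X\<close> and \<open>card Q\<close> into the stated
    degrees.\<close>
  have "replacement_data ((d + 1) ^ k) d (level_power n) (base_graph Q X) lab"
    using replacement_data_power[of n] assms(2-4) by simp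
  then show ?thesis
    using neighbor_power lab_opp_power level_graph_Suc by (simp add: Let_def)
qed

end
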